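(* Let $\{i,j\}=\{1,2\}$ and let $(X,\tau_1,\tau_2)$ be a sup-$T_D$ bispace such that every $G_\delta$-sublocale of the bilocale $(\tau_1\vee\tau_2,\tau_1,\tau_2)$ is complemented. Then $(X,\tau_1,\tau_2)$ is almost $(i,j)$-Baire if and only if the bilocale $(\tau_1\vee\tau_2,\tau_1,\tau_2)$ is $(i,j)$-Baire.
   Context: A bispace $(X,\tau_1,\tau_2)$ is a set with two topologies; $\tau_1\vee\tau_2$ is the topology generated by $\tau_1\cup\tau_2$. The bispace is sup-$T_D$ if $(X,\tau_1\vee\tau_2)$ is a $T_D$-space (each point $x$ has an open neighbourhood $U$ with $U\smallsetminus\{x\}$ open). It is almost $(i,j)$-Baire if for any collection $\{U_n:n\in\mathbb N\}$ of subsets of $X$ that are $\tau_i$-dense (dense in the space $(X,\tau_i)$) and $\tau_j$-open (members of $\tau_j$), the set $\bigcap_{n\in\mathbb N}U_n$ is $\tau_i$-dense. A locale is a complete lattice $L$ with $a\wedge\bigvee B=\bigvee\{a\wedge b:b\in B\}$ for all $a\in L$, $B\subseteq L$; $\to$ is its Heyting operation. A subframe of $L$ is a subset closed under all joins and finite meets. A bilocale is a triple $(L,L_1,L_2)$ with $L_1,L_2$ subframes of a locale $L$ such that $a=\bigvee\{a_1\wedge a_2:a_1\in L_1,a_2\in L_2,a_1\wedge a_2\le a\}$ for all $a\in L$. Here $\tau_1\vee\tau_2$ is the locale of open sets of the topology $\tau_1\vee\tau_2$, with subframes $\tau_1,\tau_2$. A sublocale of $L$ is a subset $S$ closed under all meets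 with $x\to s\in S$ for all $x\in L$, $s\in S$. Sublocales of $L$ ordered by inclusion form a coframe in which meets are intersections; the smallest sublocale is $\mathsf O=\{1\}$. A sublocale is complemented if it has a complement in this coframe. For $a\in L$, $\mathfrak o(a)=\{a\to x:x\in L\}$ is an open sublocale and $\mathfrak c(a)=\{x\in L:a\le x\}$ is a closed sublocale; these are complements of each other. A $G_\delta$-sublocale is one of the form $\bigwedge_{n\in\mathbb N}\mathfrak o(x_n)$, $x_n\in L$. A sublocale is $i$-open if it equals $\mathfrak o(a)$ for some $a\in L_i$. Put $\mathrm{cl}_i(S)=\bigcap\{\mathfrak c(a):a\in L_i,\ S\subseteq\mathfrak c(a)\}$. A sublocale $S$ is $i$-dense if $\mathrm{cl}_i(S)=L$ (equivalently $S\cap\mathfrak o(x)\ne\mathsf O$ for every nonzero $x\in L_i$). A bilocale is $(i,j)$-Baire if the intersection of any countably many $i$-dense $j$-open sublocales is $i$-dense. *)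

theory Defs
  imports "HOL-Analysis.Analysis" "HOL-Algebra.Complete_Lattice"
begin

section \<open>Frames (locales) and bilocales\<close>

text \<open>Point-free locales are modelled as complete lattices over an explicit carrier; the Isar
  notion of locale is unrelated, hence the name frame.\<close>

locale frame = complete_lattice L for L :: "('a, 'm) gorder_scheme" (structure) +
  assumes inf_Sup_distrib:
    "\<lbrakk>a \<in> carrier L; B \<subseteq> carrier L\<rbrakk> \<Longrightarrow> a \<sqinter> (\<Squnion>B) = \<Squnion>((\<lambda>b. a \<sqinter> b) ` B)"

definition heyting :: "('a, 'm) gorder_scheme \<Rightarrow> 'a \<Rightarrow> 'a \<Rightarrow> 'a" where
  "heyting L a b = \<Squnion>\<^bsub>L\<^esub> {c \<in> carrier L. a \<sqinter>\<^bsub>L\<^esub> c \<sqsubseteq>\<^bsub>L\<^esub> b}"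

definition subframe :: "('a, 'm) gorder_scheme \<Rightarrow> 'a set \<Rightarrow> bool" where
  "subframe L M \<longleftrightarrow> M \<subseteq> carrier L \<and> (\<forall>A. A \<subseteq> M \<longrightarrow> \<Squnion>\<^bsub>L\<^esub> A \<in> M)
     \<and> (\<forall>A. A \<subseteq> M \<and> finite A \<longrightarrow> \<Sqinter>\<^bsub>L\<^esub> A \<in> M)"

text \<open>The two subframes are indexed by 1 and 2; all other values of \<^term>\<open>M\<close> are irrelevant.\<close>

locale bilocale = frame L for L :: "('a, 'm) gorder_scheme" (structure) +
  fixes M :: "nat \<Rightarrow> 'a set"
  assumes subframe1: "subframe L (M 1)"
    and subframe2: "subframe L (M 2)"
    and generated: "a \<in> carrier L \<Longrightarrow>
      a = \<Squnion>{a1 \<sqinter> a2 | a1 a2. a1 \<in> M 1 \<and> a2 \<in> M 2 \<and> a1 \<sqinter> a2 \<sqsubseteq> a}"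


section \<open>Sublocales\<close>

definition is_sublocale :: "('a, 'm) gorder_scheme \<Rightarrow> 'a set \<Rightarrow> bool" where
  "is_sublocale L S \<longleftrightarrow> S \<subseteq> carrier L \<and> (\<forall>A. A \<subseteq> S \<longrightarrow> \<Sqinter>\<^bsub>L\<^esub> A \<in> S)
     \<and> (\<forall>x\<in>carrier L. \<forall>s\<in>S. heyting L x s \<in> S)"

definition sublocales :: "('a, 'm) gorder_scheme \<Rightarrow> 'a set gorder" where
  "sublocales L = \<lparr>carrier = {S. is_sublocale L S}, eq = (=), le = (\<subseteq>)\<rparr>"

definition complemented_in :: "('a, 'm) gorder_scheme \<Rightarrow> 'a \<Rightarrow> bool" where
  "complemented_in P x \<longleftrightarrow> x \<in> carrier P
     \<and> (\<exists>y\<in>carrier P. x \<sqinter>\<^bsub>P\<^esub> y = \<bottom>\<^bsub>P\<^esub> \<and> x \<squnion>\<^bsub>P\<^esub> y = \<top>\<^bsub>P\<^esub>)"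

definition open_sublocale :: "('a, 'm) gorder_scheme \<Rightarrow> 'a \<Rightarrow> 'a set" where
  "open_sublocale L a = {heyting L a x | x. x \<in> carrier L}"

definition closed_sublocale :: "('a, 'm) gorder_scheme \<Rightarrow> 'a \<Rightarrow> 'a set" where
  "closed_sublocale L a = {x \<in> carrier L. a \<sqsubseteq>\<^bsub>L\<^esub> x}"

definition Gdelta_sublocale :: "('a, 'm) gorder_scheme \<Rightarrow> 'a set \<Rightarrow> bool" where
  "Gdelta_sublocale L S \<longleftrightarrow> (\<exists>x :: nat \<Rightarrow> 'a. range x \<subseteq> carrier L
     \<and> S = \<Sqinter>\<^bsub>sublocales L\<^esub> (range (\<lambda>n. open_sublocale L (x n))))"

definition i_open :: "('a, 'm) gorder_scheme \<Rightarrow> (nat \<Rightarrow> 'a set) \<Rightarrow> nat \<Rightarrow> 'a set \<Rightarrow> bool" where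
  "i_open L M i S \<longleftrightarrow> (\<exists>a\<in>M i. S = open_sublocale L a)"

definition i_closure :: "('a, 'm) gorder_scheme \<Rightarrow> (nat \<Rightarrow> 'a set) \<Rightarrow> nat \<Rightarrow> 'a set \<Rightarrow> 'a set" where
  "i_closure L M i S = \<Inter>{closed_sublocale L a | a. a \<in> M i \<and> S \<subseteq> closed_sublocale L a}"

definition i_dense :: "('a, 'm) gorder_scheme \<Rightarrow> (nat \<Rightarrow> 'a set) \<Rightarrow> nat \<Rightarrow> 'a set \<Rightarrow> bool" where
  "i_dense L M i S \<longleftrightarrow> i_closure L M i S = carrier L"

definition Baire_bilocale ::
    "('a, 'm) gorder_scheme \<Rightarrow> (nat \<Rightarrow> 'a set) \<Rightarrow> nat \<Rightarrow> nat \<Rightarrow> bool" where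
  "Baire_bilocale L M i j \<longleftrightarrow> (\<forall>S :: nat \<Rightarrow> 'a set.
     (\<forall>n. i_dense L M i (S n) \<and> i_open L M j (S n)) \<longrightarrow> i_dense L M i (\<Inter>n. S n))"


section \<open>Bispaces\<close>

definition bispace :: "'a set \<Rightarrow> (nat \<Rightarrow> 'a topology) \<Rightarrow> bool" where
  "bispace X T \<longleftrightarrow> topspace (T 1) = X \<and> topspace (T 2) = X"

definition sup_topology :: "(nat \<Rightarrow> 'a topology) \<Rightarrow> 'a topology" where
  "sup_topology T = topology_generated_by ({U. openin (T 1) U} \<union> {U. openin (T 2) U})"

definition TD_space :: "'a topology \<Rightarrow> bool" where
  "TD_space T \<longleftrightarrow> (\<forall>x\<in>topspace T. \<exists>U. openin T U \<and> x \<in> U \<and> openin T (U - {x}))"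

definition sup_TD :: "(nat \<Rightarrow> 'a topology) \<Rightarrow> bool" where
  "sup_TD T \<longleftrightarrow> TD_space (sup_topology T)"

definition dense_in :: "'a topology \<Rightarrow> 'a set \<Rightarrow> bool" where
  "dense_in T S \<longleftrightarrow> S \<subseteq> topspace T \<and> T closure_of S = topspace T"

definition almost_Baire :: "(nat \<Rightarrow> 'a topology) \<Rightarrow> nat \<Rightarrow> nat \<Rightarrow> bool" where
  "almost_Baire T i j \<longleftrightarrow> (\<forall>U :: nat \<Rightarrow> 'a set.
     (\<forall>n. dense_in (T i) (U n) \<and> openin (T j) (U n)) \<longrightarrow> dense_in (T i) (\<Inter>n. U n))"

definition opens :: "'a topology \<Rightarrow> 'a set gorder" where
  "opens T = \<lparr>carrier = {U. openin T U}, eq = (=), le = (\<subseteq>)\<rparr>"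

definition open_subframes :: "(nat \<Rightarrow> 'a topology) \<Rightarrow> nat \<Rightarrow> 'a set set" where
  "open_subframes T i = {U. openin (T i) U}"


section \<open>The bilocale of a bispace\<close>

text \<open>The general notions above do apply to bispaces: the opens form a frame and the two
  topologies make it a bilocale. Moreover, the sublocales of a frame form a complete lattice
  with intersections as meets and \<open>{1}\<close> as least element.\<close>

lemma opens_simps [simp]:
  "carrier (opens T) = {U. openin T U}" "eq (opens T) = (=)" "le (opens T) = (\<subseteq>)"
  by (simp_all add: opens_def)

lemma sublocales_simps [simp]:
  "carrier (sublocales L) = {S. is_sublocale L S}" "eq (sublocales L) = (=)"
  "le (sublocales L) = (\<subseteq>)"
  by (simp_all add: sublocales_def)

lemma partial_order_opens: "partial_order (opens T)"
  by unfold_locales auto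

lemma partial_order_sublocales: "partial_order (sublocales L)"
  by unfold_locales auto

lemma opens_least: "(\<And>U. U \<in> A \<Longrightarrow> openin T U) \<Longrightarrow> least (opens T) (\<Union>A) (Upper (opens T) A)"
  by (auto simp: least_def Upper_def)

lemma opens_greatest:
  "(\<And>U. U \<in> A \<Longrightarrow> openin T U) \<Longrightarrow>
    greatest (opens T) (T interior_of (topspace T \<inter> \<Inter>A)) (Lower (opens T) A)"
  unfolding greatest_def Lower_def
proof (intro conjI ballI subsetI CollectI)
  fix y assume "y \<in> {l. \<forall>x. x \<in> A \<inter> carrier (opens T) \<longrightarrow> l \<sqsubseteq>\<^bsub>opens T\<^esub> x} \<inter> carrier (opens T)"
  moreover assume "\<And>U. U \<in> A \<Longrightarrow> openin T U"
  ultimately have "y \<subseteq> topspace T \<inter> \<Inter>A" and "openin T y"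
    using openin_subset[of T y] by auto
  then show "y \<sqsubseteq>\<^bsub>opens T\<^esub> T interior_of (topspace T \<inter> \<Inter>A)"
    by (simp add: interior_of_maximal)
qed (use interior_of_subset[of T "topspace T \<inter> \<Inter>A"] in auto)

lemma complete_lattice_opens: "complete_lattice (opens T)"
proof -
  interpret partial_order "opens T" by (rule partial_order_opens)
  show ?thesis
  proof
    fix A assume "A \<subseteq> carrier (opens T)"
    then have "U \<in> A \<Longrightarrow> openin T U" for U by auto
    then show "\<exists>s. is_lub (opens T) s A" "\<exists>i. is_glb (opens T) i A"
      using opens_least[of A T] opens_greatest[of A T] by blast+
  qed
qed

lemma opens_Sup: "(\<And>U. U \<in> A \<Longrightarrow> openin T U) \<Longrightarrow> \<Squnion>\<^bsub>opens T\<^esub> A = \<Union>A"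
proof -
  interpret complete_lattice "opens T" by (rule complete_lattice_opens)
  assume A: "\<And>U. U \<in> A \<Longrightarrow> openin T U"
  then have "least (opens T) (\<Squnion>\<^bsub>opens T\<^esub> A) (Upper (opens T) A)"
    by (auto intro!: sup_lub)
  with opens_least[OF A] show ?thesis
    using least_unique by blast
qed

lemma opens_Inf:
  "(\<And>U. U \<in> A \<Longrightarrow> openin T U) \<Longrightarrow> \<Sqinter>\<^bsub>opens T\<^esub> A = T interior_of (topspace T \<inter> \<Inter>A)"
proof -
  interpret complete_lattice "opens T" by (rule complete_lattice_opens)
  assume A: "\<And>U. U \<in> A \<Longrightarrow> openin T U"
  then have "greatest (opens T) (\<Sqinter>\<^bsub>opens T\<^esub> A) (Lower (opens T) A)"
    by (auto intro!: inf_glb)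
  with opens_greatest[OF A] show ?thesis
    using greatest_unique by blast
qed

lemma opens_inf:
  assumes "openin T U" "openin T V" shows "U \<sqinter>\<^bsub>opens T\<^esub> V = U \<inter> V"
proof -
  have "U \<sqinter>\<^bsub>opens T\<^esub> V = T interior_of (topspace T \<inter> \<Inter>{U, V})"
    unfolding meet_def using assms by (intro opens_Inf) auto
  also have "topspace T \<inter> \<Inter>{U, V} = U \<inter> V"
    using assms openin_subset by fastforce
  finally show ?thesis
    using assms by (simp add: interior_of_openin openin_Int)
qed

lemma frame_opens: "frame (opens T)"
proof -
  interpret complete_lattice "opens T" by (rule complete_lattice_opens)
  show ?thesis
  proof
    fix a B assume "a \<in> carrier (opens T)" "B \<subseteq> carrier (opens T)"
    then have a: "openin T a" and B: "\<And>b. b \<in> B \<Longrightarrow> openin T b" by auto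
    have im: "(\<lambda>b. a \<sqinter>\<^bsub>opens T\<^esub> b) ` B = (\<lambda>b. a \<inter> b) ` B"
      using a B by (auto simp: opens_inf)
    have "\<Squnion>\<^bsub>opens T\<^esub> ((\<lambda>b. a \<inter> b) ` B) = \<Union>((\<lambda>b. a \<inter> b) ` B)"
      using a B by (intro opens_Sup) auto
    moreover have "a \<sqinter>\<^bsub>opens T\<^esub> (\<Squnion>\<^bsub>opens T\<^esub> B) = a \<inter> \<Union>B"
      using a B by (simp add: opens_Sup opens_inf openin_Union)
    ultimately show "a \<sqinter>\<^bsub>opens T\<^esub> (\<Squnion>\<^bsub>opens T\<^esub> B) = \<Squnion>\<^bsub>opens T\<^esub> ((\<lambda>b. a \<sqinter>\<^bsub>opens T\<^esub> b) ` B)"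
      unfolding im by auto
  qed
qed

lemma openin_sup_topology: "k \<in> {1, 2} \<Longrightarrow> openin (T k) U \<Longrightarrow> openin (sup_topology T) U"
  unfolding sup_topology_def by (rule topology_generated_by_Basis) auto

lemma topspace_sup_topology: "bispace X T \<Longrightarrow> topspace (sup_topology T) = X"
  unfolding sup_topology_def bispace_def topology_generated_by_topspace
  by (auto dest: openin_subset)

lemma sup_topology_base:
  assumes "bispace X T" "openin (sup_topology T) U" "x \<in> U"
  shows "\<exists>V W. openin (T 1) V \<and> openin (T 2) W \<and> x \<in> V \<inter> W \<and> V \<inter> W \<subseteq> U"
proof -
  have "generate_topology_on ({U. openin (T 1) U} \<union> {U. openin (T 2) U}) U"
    using assms(2) by (simp add: sup_topology_def openin_topology_generated_by_iff)
  then show ?thesis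
    using assms(3)
  proof (induction arbitrary: x)
    case (Int a b)
    then obtain V W V' W' where
      "openin (T 1) V" "openin (T 2) W" "x \<in> V \<inter> W" "V \<inter> W \<subseteq> a"
      "openin (T 1) V'" "openin (T 2) W'" "x \<in> V' \<inter> W'" "V' \<inter> W' \<subseteq> b"
      by (metis IntD1 IntD2)
    then show ?case
      by (intro exI[of _ "V \<inter> V'"] exI[of _ "W \<inter> W'"]) auto
  next
    case (UN K)
    then obtain k where k: "k \<in> K" "x \<in> k" by blast
    then obtain V W where "openin (T 1) V" "openin (T 2) W" "x \<in> V \<inter> W" "V \<inter> W \<subseteq> k"
      using UN.IH by meson
    with k show ?case by blast
  next
    case (Basis s)
    then have s: "openin (T 1) s \<or> openin (T 2) s" by simp
    have tops: "topspace (T 1) = X" "topspace (T 2) = X"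
      using assms(1) by (auto simp: bispace_def)
    have opX: "openin (T 1) X" "openin (T 2) X"
      using openin_topspace[of "T 1"] openin_topspace[of "T 2"] unfolding tops by auto
    from s show ?case
    proof
      assume o: "openin (T 1) s"
      then have "x \<in> X" using Basis.prems tops openin_subset by blast
      with o show ?thesis
        using Basis.prems opX by (intro exI[of _ s] exI[of _ X]) simp
    next
      assume o: "openin (T 2) s"
      then have "x \<in> X" using Basis.prems tops openin_subset by blast
      with o show ?thesis
        using Basis.prems opX by (intro exI[of _ X] exI[of _ s]) simp
    qed
  qed simp
qed

lemma subframe_opens:
  assumes B: "bispace X T" and k: "k \<in> {1, 2}"
  shows "subframe (opens (sup_topology T)) (open_subframes T k)"
  unfolding subframe_def
proof (intro conjI allI impI)
  show "open_subframes T k \<subseteq> carrier (opens (sup_topology T))"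
    using openin_sup_topology[OF k] by (auto simp: open_subframes_def)
next
  fix A assume "A \<subseteq> open_subframes T k"
  then have A: "\<And>U. U \<in> A \<Longrightarrow> openin (T k) U" by (auto simp: open_subframes_def)
  then show "\<Squnion>\<^bsub>opens (sup_topology T)\<^esub> A \<in> open_subframes T k"
    by (subst opens_Sup) (auto simp: open_subframes_def openin_sup_topology[OF k])
next
  fix A assume "A \<subseteq> open_subframes T k \<and> finite A"
  then have A: "\<And>U. U \<in> A \<Longrightarrow> openin (T k) U" and fin: "finite A"
    by (auto simp: open_subframes_def)
  have X: "topspace (T k) = X" "topspace (sup_topology T) = X"
    using B k topspace_sup_topology[OF B] by (auto simp: bispace_def)
  have "openin (T k) (topspace (T k) \<inter> \<Inter>A)"
    using fin A
  proof (induction A)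
    case (insert U A)
    have "topspace (T k) \<inter> \<Inter>(insert U A) = U \<inter> (topspace (T k) \<inter> \<Inter>A)" by auto
    with insert show ?case by (simp add: openin_Int)
  qed simp
  then have "openin (T k) (X \<inter> \<Inter>A)" using X by simp
  moreover have "openin (sup_topology T) (X \<inter> \<Inter>A)"
    using calculation openin_sup_topology[OF k] by blast
  moreover have "\<Sqinter>\<^bsub>opens (sup_topology T)\<^esub> A = sup_topology T interior_of (X \<inter> \<Inter>A)"
    unfolding X(2)[symmetric] by (rule opens_Inf) (use A openin_sup_topology[OF k] in blast)
  ultimately show "\<Sqinter>\<^bsub>opens (sup_topology T)\<^esub> A \<in> open_subframes T k"
    by (simp add: open_subframes_def interior_of_openin)
qed

lemma bilocale_of_bispace:
  assumes B: "bispace X T"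
  shows "bilocale (opens (sup_topology T)) (open_subframes T)"
proof -
  let ?S = "sup_topology T"
  interpret frame "opens ?S" by (rule frame_opens)
  show ?thesis
  proof
    show "subframe (opens ?S) (open_subframes T 1)" "subframe (opens ?S) (open_subframes T 2)"
      using subframe_opens[OF B] by auto
  next
    fix a assume "a \<in> carrier (opens ?S)"
    then have a: "openin ?S a" by simp
    have o: "openin (T 1) U \<Longrightarrow> openin ?S U" "openin (T 2) U \<Longrightarrow> openin ?S U" for U
      using openin_sup_topology[of 1 T U] openin_sup_topology[of 2 T U] by auto
    have "{a1 \<sqinter>\<^bsub>opens ?S\<^esub> a2 | a1 a2. a1 \<in> open_subframes T 1 \<and> a2 \<in> open_subframes T 2
          \<and> a1 \<sqinter>\<^bsub>opens ?S\<^esub> a2 \<sqsubseteq>\<^bsub>opens ?S\<^esub> a}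
        = {a1 \<inter> a2 | a1 a2. openin (T 1) a1 \<and> openin (T 2) a2 \<and> a1 \<inter> a2 \<subseteq> a}" (is "?L = ?R")
      unfolding open_subframes_def using o by (auto simp: opens_inf) (metis o opens_inf)+
    moreover have "\<Squnion>\<^bsub>opens ?S\<^esub> ?R = \<Union>?R"
      by (rule opens_Sup) (use o in blast)
    moreover have "\<Union>?R = a"
      using sup_topology_base[OF B a] by blast
    ultimately show "a = \<Squnion>\<^bsub>opens ?S\<^esub> ?L" by simp
  qed
qed

context frame
begin

lemma heyting_closed: "heyting L a b \<in> carrier L"
  unfolding heyting_def by (rule sup_closed) auto

lemma is_sublocale_Inter:
  assumes "\<And>S. S \<in> F \<Longrightarrow> is_sublocale L S"
  shows "is_sublocale L (carrier L \<inter> \<Inter>F)"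
  unfolding is_sublocale_def
proof (intro conjI allI impI ballI)
  fix A assume A: "A \<subseteq> carrier L \<inter> \<Inter>F"
  have "\<Sqinter>A \<in> S" if "S \<in> F" for S
  proof -
    have "A \<subseteq> S" using A that by blast
    with assms[OF that] show ?thesis by (simp add: is_sublocale_def)
  qed
  moreover have "\<Sqinter>A \<in> carrier L" using A by (intro inf_closed) simp
  ultimately show "\<Sqinter>A \<in> carrier L \<inter> \<Inter>F" by simp
next
  fix x s assume "x \<in> carrier L" "s \<in> carrier L \<inter> \<Inter>F"
  then show "heyting L x s \<in> carrier L \<inter> \<Inter>F"
    using assms by (simp add: is_sublocale_def heyting_closed)
qed auto

lemma is_sublocale_subset: "is_sublocale L S \<Longrightarrow> S \<subseteq> carrier L"
  by (simp add: is_sublocale_def)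

lemma sublocales_greatest:
  assumes "\<And>S. S \<in> F \<Longrightarrow> is_sublocale L S"
  shows "greatest (sublocales L) (carrier L \<inter> \<Inter>F) (Lower (sublocales L) F)"
  unfolding greatest_def Lower_def
proof (intro conjI ballI subsetI)
  show "carrier L \<inter> \<Inter>F \<in> {l. \<forall>x. x \<in> F \<inter> carrier (sublocales L) \<longrightarrow> l \<sqsubseteq>\<^bsub>sublocales L\<^esub> x}
      \<inter> carrier (sublocales L)"
    using is_sublocale_Inter[OF assms] by auto
next
  fix S assume "S \<in> {l. \<forall>x. x \<in> F \<inter> carrier (sublocales L) \<longrightarrow> l \<sqsubseteq>\<^bsub>sublocales L\<^esub> x}
      \<inter> carrier (sublocales L)"
  then have "is_sublocale L S" "\<And>R. R \<in> F \<Longrightarrow> S \<subseteq> R"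
    using assms by auto
  then show "S \<sqsubseteq>\<^bsub>sublocales L\<^esub> carrier L \<inter> \<Inter>F"
    using is_sublocale_subset by (simp add: Inter_greatest)
qed auto

lemma complete_lattice_sublocales: "complete_lattice (sublocales L)"
proof -
  interpret S: partial_order "sublocales L" by (rule partial_order_sublocales)
  have top: "is_sublocale L (carrier L)"
    using is_sublocale_Inter[of "{}"] by simp
  show ?thesis
  proof (rule S.complete_lattice_criterion1)
    show "\<exists>g. greatest (sublocales L) g (carrier (sublocales L))"
      using top is_sublocale_subset by (auto simp: greatest_def)
  next
    fix A assume "A \<subseteq> carrier (sublocales L)" "A \<noteq> {}"
    then show "\<exists>i. greatest (sublocales L) i (Lower (sublocales L) A)"
      using sublocales_greatest[of A] by auto
  qed
qed

lemma sublocales_Inf: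
  assumes "F \<noteq> {}" "\<And>S. S \<in> F \<Longrightarrow> is_sublocale L S"
  shows "\<Sqinter>\<^bsub>sublocales L\<^esub> F = \<Inter>F"
proof -
  interpret S: complete_lattice "sublocales L" by (rule complete_lattice_sublocales)
  have "F \<subseteq> carrier (sublocales L)" using assms by auto
  then have "greatest (sublocales L) (\<Sqinter>\<^bsub>sublocales L\<^esub> F) (Lower (sublocales L) F)"
    by (rule S.inf_glb)
  then have "\<Sqinter>\<^bsub>sublocales L\<^esub> F = carrier L \<inter> \<Inter>F"
    using sublocales_greatest[OF assms(2)] S.greatest_unique by blast
  moreover from assms obtain R where "R \<in> F" "R \<subseteq> carrier L"
    using is_sublocale_subset by (meson ex_in_conv)
  then have "\<Inter>F \<subseteq> carrier L" by blast
  ultimately show ?thesis by (simp add: Int_absorb1)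
qed

lemma sublocales_bottom: "\<bottom>\<^bsub>sublocales L\<^esub> = {\<top>}"
proof -
  interpret S: complete_lattice "sublocales L" by (rule complete_lattice_sublocales)
  have 1: "\<Sqinter>{} = \<top>"
    by (rule le_antisym[OF top_higher inf_greatest]) simp_all
  have 2: "is_sublocale L {\<top>}"
    unfolding is_sublocale_def
  proof (intro conjI allI impI ballI)
    fix A assume "A \<subseteq> {\<top>}"
    then consider "A = {}" | "A = {\<top>}" by blast
    then show "\<Sqinter>A \<in> {\<top>}"
      by cases (simp_all add: 1 inf_of_singleton_closed)
  next
    fix x s assume x: "x \<in> carrier L" and "s \<in> {\<top>}"
    have "{c \<in> carrier L. x \<sqinter> c \<sqsubseteq> \<top>} = carrier L"
      using x by (auto intro: top_higher)
    moreover have "\<Squnion>(carrier L) = \<top>"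
      by (rule le_antisym[OF top_higher sup_upper]) simp_all
    ultimately show "heyting L x s \<in> {\<top>}"
      using \<open>s \<in> {\<top>}\<close> by (simp add: heyting_def)
  qed (simp add: top_closed)
  have 3: "{\<top>} \<subseteq> S" if "is_sublocale L S" for S
    using that 1 unfolding is_sublocale_def by (metis empty_subsetI insert_subset)
  show ?thesis
    using 2 3[of "\<bottom>\<^bsub>sublocales L\<^esub>"] S.bottom_lower[of "{\<top>}"] S.bottom_closed by auto
qed

end

end

theory Submission
  imports Defs
begin

text \<open>A point \<open>x\<close> of a space gives the prime open set \<open>p x\<close>, the complement of the closure of
  \<open>{x}\<close>. It belongs to the open sublocale of \<open>U\<close> exactly when \<open>x \<in> U\<close>, and the open sublocale of
  \<open>U\<close> consists of the meets of sets \<open>p x\<close> with \<open>x \<in> U\<close>. Hence a point of \<open>V \<inter> (\<Inter>n. U n)\<close> shows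
  that the intersection of the open sublocales of the \<open>U n\<close> meets the one of \<open>V\<close>. Conversely, let
  \<open>S'\<close> be a complement of that intersection \<open>S\<close>. Since \<open>p x\<close> is prime, it lies in \<open>S\<close> or in \<open>S'\<close>;
  so if \<open>V \<inter> (\<Inter>n. U n)\<close> is empty, all \<open>p x\<close> with \<open>x \<in> V\<close> lie in \<open>S'\<close>, hence so does the open
  sublocale of \<open>V\<close>, which therefore is disjoint from \<open>S\<close>.\<close>

section \<open>Heyting operation and meets in the frame of open sets\<close>

lemma heyting_opens:
  assumes "openin T U" "openin T V"
  shows "heyting (opens T) U V = T interior_of (topspace T - U \<union> V)"
proof -
  have "{C \<in> carrier (opens T). U \<sqinter>\<^bsub>opens T\<^esub> C \<sqsubseteq>\<^bsub>opens T\<^esub> V} = {C. openin T C \<and> U \<inter> C \<subseteq> V}"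
    using assms by (auto simp: opens_inf)
  then have "heyting (opens T) U V = \<Union>{C. openin T C \<and> U \<inter> C \<subseteq> V}"
    unfolding heyting_def by (simp only:) (rule opens_Sup, simp)
  also have "\<dots> = T interior_of (topspace T - U \<union> V)"
    unfolding interior_of_def using openin_subset by fastforce
  finally show ?thesis .
qed

lemma openin_heyting:
  "openin T U \<Longrightarrow> openin T V \<Longrightarrow> openin T (heyting (opens T) U V)"
  by (simp add: heyting_opens)

text \<open>An open set lies in an interior iff it lies in the set itself, so the interior from
  \<open>heyting_opens\<close> disappears. From here on the Heyting operation is handled through
  this adjunction.\<close>

lemma subset_heyting_opens_iff:
  assumes "openin T U" "openin T V" "openin T W"
  shows "W \<subseteq> heyting (opens T) U V \<longleftrightarrow> U \<inter> W \<subseteq> V"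
proof -
  have "W \<subseteq> heyting (opens T) U V \<longleftrightarrow> W \<subseteq> topspace T - U \<union> V"
    using assms interior_of_subset[of T "topspace T - U \<union> V"]
    by (auto simp: heyting_opens interior_of_maximal_eq)
  also have "\<dots> \<longleftrightarrow> U \<inter> W \<subseteq> V"
    using openin_subset[OF assms(3)] by auto
  finally show ?thesis .
qed

text \<open>Serves to prove equations between Heyting terms and meets by chains of adjunctions,
  testing both sides on an arbitrary open set instead of computing interiors.\<close>

lemma opens_eqI:
  assumes "openin T U" "openin T V" "\<And>W. openin T W \<Longrightarrow> W \<subseteq> U \<longleftrightarrow> W \<subseteq> V"
  shows "U = V"
  using assms by blast

lemma subset_opens_Inf_iff:
  assumes "\<And>U. U \<in> A \<Longrightarrow> openin T U" "openin T W"
  shows "W \<subseteq> \<Sqinter>\<^bsub>opens T\<^esub> A \<longleftrightarrow> (\<forall>U\<in>A. W \<subseteq> U)"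
  using assms openin_subset[OF assms(2)] by (auto simp: opens_Inf interior_of_maximal_eq)

lemma openin_opens_Inf:
  "(\<And>U. U \<in> A \<Longrightarrow> openin T U) \<Longrightarrow> openin T (\<Sqinter>\<^bsub>opens T\<^esub> A)"
  by (simp add: opens_Inf)

lemma opens_top: "\<top>\<^bsub>opens T\<^esub> = topspace T"
proof -
  interpret complete_lattice "opens T" by (rule complete_lattice_opens)
  show ?thesis
    using top_higher[of "topspace T"] top_closed openin_subset by fastforce
qed

section \<open>Sublocales of the frame of open sets, in particular the open ones\<close>

lemma openin_is_sublocale: "is_sublocale (opens T) S \<Longrightarrow> U \<in> S \<Longrightarrow> openin T U"
  by (auto simp: is_sublocale_def)

lemma topspace_in_sublocale:
  assumes "is_sublocale (opens T) S" shows "topspace T \<in> S"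
proof -
  have "\<Sqinter>\<^bsub>opens T\<^esub> {} \<in> S"
    using assms by (simp add: is_sublocale_def)
  moreover have "\<Sqinter>\<^bsub>opens T\<^esub> {} = topspace T"
    by (subst opens_Inf) (simp_all add: interior_of_openin)
  ultimately show ?thesis by simp
qed

text \<open>The operator \<open>heyting (opens T) U\<close> is idempotent, because intersecting with
  \<open>U\<close> twice is the same as once; so its range is its set of fixed points.\<close>

lemma open_sublocale_opens_iff:
  assumes "openin T U"
  shows "W \<in> open_sublocale (opens T) U \<longleftrightarrow> openin T W \<and> heyting (opens T) U W = W"
proof
  assume "W \<in> open_sublocale (opens T) U"
  then obtain V where V: "openin T V" and W: "W = heyting (opens T) U V"
    by (auto simp: open_sublocale_def)
  have oW: "openin T W" using W V assms openin_heyting by blast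
  have "heyting (opens T) U W = W"
  proof (rule opens_eqI)
    fix D assume D: "openin T D"
    have "D \<subseteq> heyting (opens T) U W \<longleftrightarrow> U \<inter> D \<subseteq> W"
      using assms oW D by (rule subset_heyting_opens_iff)
    also have "\<dots> \<longleftrightarrow> D \<subseteq> W"
      using V assms D by (simp add: W subset_heyting_opens_iff openin_Int)
    finally show "D \<subseteq> heyting (opens T) U W \<longleftrightarrow> D \<subseteq> W" .
  qed (use oW assms openin_heyting in blast)+
  with oW show "openin T W \<and> heyting (opens T) U W = W" by simp
next
  assume "openin T W \<and> heyting (opens T) U W = W"
  then show "W \<in> open_sublocale (opens T) U"
    unfolding open_sublocale_def by force
qed

text \<open>The operator \<open>heyting (opens T) U\<close> preserves meets and commutes with every
  \<open>heyting (opens T) V\<close>, so its fixed points are closed under both operations.\<close>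

lemma is_sublocale_open_sublocale:
  assumes U: "openin T U"
  shows "is_sublocale (opens T) (open_sublocale (opens T) U)"
  unfolding is_sublocale_def
proof (intro conjI allI impI ballI)
  show "open_sublocale (opens T) U \<subseteq> carrier (opens T)"
    using U by (auto simp: open_sublocale_opens_iff)
next
  fix A assume "A \<subseteq> open_sublocale (opens T) U"
  then have A: "\<And>W. W \<in> A \<Longrightarrow> openin T W" "\<And>W. W \<in> A \<Longrightarrow> heyting (opens T) U W = W"
    using U by (auto simp: open_sublocale_opens_iff)
  let ?I = "\<Sqinter>\<^bsub>opens T\<^esub> A"
  have I: "openin T ?I" using A openin_opens_Inf by blast
  have "heyting (opens T) U ?I = ?I"
  proof (rule opens_eqI)
    fix D assume D: "openin T D"
    then have "D \<subseteq> heyting (opens T) U ?I \<longleftrightarrow> (\<forall>W\<in>A. U \<inter> D \<subseteq> W)"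
      using U I A by (simp add: subset_heyting_opens_iff subset_opens_Inf_iff openin_Int)
    also have "\<dots> \<longleftrightarrow> (\<forall>W\<in>A. D \<subseteq> W)"
      using U D A subset_heyting_opens_iff by metis
    also have "\<dots> \<longleftrightarrow> D \<subseteq> ?I"
      using A D by (simp add: subset_opens_Inf_iff)
    finally show "D \<subseteq> heyting (opens T) U ?I \<longleftrightarrow> D \<subseteq> ?I" .
  qed (use I U openin_heyting in blast)+
  with I U show "?I \<in> open_sublocale (opens T) U"
    by (simp add: open_sublocale_opens_iff)
next
  fix V W assume "V \<in> carrier (opens T)" "W \<in> open_sublocale (opens T) U"
  then have V: "openin T V" and W: "openin T W" and eq: "heyting (opens T) U W = W"
    using U by (auto simp: open_sublocale_opens_iff)
  let ?H = "heyting (opens T) V W"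
  have H: "openin T ?H" using V W by (rule openin_heyting)
  have "heyting (opens T) U ?H = ?H"
  proof (rule opens_eqI)
    fix D assume D: "openin T D"
    then have "D \<subseteq> heyting (opens T) U ?H \<longleftrightarrow> U \<inter> (V \<inter> D) \<subseteq> W"
      using U V W H by (simp add: subset_heyting_opens_iff openin_Int Int_left_commute)
    also have "\<dots> \<longleftrightarrow> V \<inter> D \<subseteq> heyting (opens T) U W"
      using U V W D by (simp add: subset_heyting_opens_iff openin_Int)
    also have "\<dots> \<longleftrightarrow> D \<subseteq> ?H"
      using V W D by (simp add: eq subset_heyting_opens_iff)
    finally show "D \<subseteq> heyting (opens T) U ?H \<longleftrightarrow> D \<subseteq> ?H" .
  qed (use H U openin_heyting in blast)+
  with H U show "?H \<in> open_sublocale (opens T) U"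
    by (simp add: open_sublocale_opens_iff)
qed

section \<open>Prime open sets of points\<close>

definition point_prime :: "'a topology \<Rightarrow> 'a \<Rightarrow> 'a set" where
  "point_prime T x = topspace T - T closure_of {x}"

lemma openin_point_prime: "openin T (point_prime T x)"
  by (simp add: point_prime_def openin_diff)

text \<open>An open set meets the closure of \<open>{x}\<close> only if it contains
  \<open>x\<close>. Thus the prime is the largest open set missing \<open>x\<close>.\<close>

lemma subset_point_prime_iff:
  assumes "openin T U" "x \<in> topspace T"
  shows "U \<subseteq> point_prime T x \<longleftrightarrow> x \<notin> U"
proof -
  have "U \<inter> T closure_of {x} = {} \<longleftrightarrow> U \<inter> {x} = {}"
    using assms(1) by (rule openin_Int_closure_of_eq_empty)
  then show ?thesis
    using openin_subset[OF assms(1)] by (auto simp: point_prime_def)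
qed

text \<open>For \<open>x\<close> in \<open>U\<close>, an open \<open>D\<close> misses
  \<open>x\<close> iff \<open>U \<inter> D\<close> does, which makes the prime a fixed point. For
  \<open>x\<close> outside \<open>U\<close>, the set \<open>U\<close> lies below the prime, so the
  Heyting operation yields the whole space, whereas the prime misses \<open>x\<close>.\<close>

lemma point_prime_in_open_sublocale_iff:
  assumes U: "openin T U" and x: "x \<in> topspace T"
  shows "point_prime T x \<in> open_sublocale (opens T) U \<longleftrightarrow> x \<in> U"
proof
  assume "x \<in> U"
  have "heyting (opens T) U (point_prime T x) = point_prime T x"
    by (rule opens_eqI[where T = T])
      (use U x \<open>x \<in> U\<close> in \<open>auto simp: openin_heyting openin_point_prime subset_heyting_opens_iff
        openin_Int subset_point_prime_iff\<close>)
  then show "point_prime T x \<in> open_sublocale (opens T) U"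
    using U by (simp add: open_sublocale_opens_iff openin_point_prime)
next
  assume "point_prime T x \<in> open_sublocale (opens T) U"
  then have eq: "heyting (opens T) U (point_prime T x) = point_prime T x"
    using U by (simp add: open_sublocale_opens_iff)
  have "topspace T \<subseteq> heyting (opens T) U (point_prime T x)" if "x \<notin> U"
    using that U x openin_subset[OF U]
    by (simp add: subset_heyting_opens_iff openin_point_prime Int_absorb2 subset_point_prime_iff)
  then show "x \<in> U"
    using x subset_point_prime_iff[of T "topspace T" x] by (auto simp: eq)
qed

text \<open>Since \<open>W\<close> is a fixed point, an open \<open>D\<close> lies in
  \<open>W\<close> as soon as \<open>U \<inter> D\<close> does, that is, as soon as \<open>D\<close>
  misses each point of \<open>U - W\<close>. Only primes of points of \<open>U\<close> are therefore
  required.\<close>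

lemma open_sublocale_eq_Inf_point_prime:
  assumes U: "openin T U" and W: "W \<in> open_sublocale (opens T) U"
  shows "W = \<Sqinter>\<^bsub>opens T\<^esub> (point_prime T ` (U - W))"
proof (rule opens_eqI)
  have oW: "openin T W" and eq: "heyting (opens T) U W = W"
    using U W by (auto simp: open_sublocale_opens_iff)
  show "openin T W" by (rule oW)
  show "openin T (\<Sqinter>\<^bsub>opens T\<^esub> (point_prime T ` (U - W)))"
    by (rule openin_opens_Inf) (auto simp: openin_point_prime)
  fix D assume D: "openin T D"
  have "D \<subseteq> \<Sqinter>\<^bsub>opens T\<^esub> (point_prime T ` (U - W)) \<longleftrightarrow> (\<forall>x\<in>U - W. D \<subseteq> point_prime T x)"
    using D by (subst subset_opens_Inf_iff) (auto simp: openin_point_prime)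
  also have "\<dots> \<longleftrightarrow> (\<forall>x\<in>U - W. x \<notin> D)"
    using D openin_subset[OF U] by (meson DiffD1 subsetD subset_point_prime_iff)
  also have "\<dots> \<longleftrightarrow> U \<inter> D \<subseteq> W" by blast
  also have "\<dots> \<longleftrightarrow> D \<subseteq> W"
    using subset_heyting_opens_iff[OF U oW D] by (simp add: eq)
  finally show "D \<subseteq> W \<longleftrightarrow> D \<subseteq> \<Sqinter>\<^bsub>opens T\<^esub> (point_prime T ` (U - W))" by simp
qed

section \<open>Complemented sublocales and primes\<close>

text \<open>This set is the join of \<open>R\<close> and \<open>S\<close> among the sublocales; it
  makes the elements of a join explicit.\<close>

lemma is_sublocale_pairwise_Int:
  assumes R: "is_sublocale (opens T) R" and S: "is_sublocale (opens T) S"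
  shows "is_sublocale (opens T) {U \<inter> V | U V. U \<in> R \<and> V \<in> S}"
  unfolding is_sublocale_def
proof (intro conjI allI impI ballI)
  note oR = openin_is_sublocale[OF R] and oS = openin_is_sublocale[OF S]
  show "{U \<inter> V | U V. U \<in> R \<and> V \<in> S} \<subseteq> carrier (opens T)"
    using oR oS by auto
  {
    fix A assume A: "A \<subseteq> {U \<inter> V | U V. U \<in> R \<and> V \<in> S}"
    then have oA: "openin T W" if "W \<in> A" for W
      using that oR oS by blast
    \<comment> \<open>All components occurring in any decomposition of a member of \<open>A\<close>
      are collected, which avoids choosing one decomposition per member and leaves the meet
      unchanged.\<close>
    define B where "B = {U \<in> R. \<exists>V\<in>S. U \<inter> V \<in> A}"
    define C where "C = {V \<in> S. \<exists>U\<in>R. U \<inter> V \<in> A}"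
    have oB: "\<And>W. W \<in> B \<Longrightarrow> openin T W" and oC: "\<And>W. W \<in> C \<Longrightarrow> openin T W"
      using oR oS by (auto simp: B_def C_def)
    have mem: "\<Sqinter>\<^bsub>opens T\<^esub> B \<in> R" "\<Sqinter>\<^bsub>opens T\<^esub> C \<in> S"
      using R S by (auto simp: is_sublocale_def B_def C_def)
    have "\<Sqinter>\<^bsub>opens T\<^esub> A = \<Sqinter>\<^bsub>opens T\<^esub> B \<inter> \<Sqinter>\<^bsub>opens T\<^esub> C"
    proof (rule opens_eqI)
      fix D assume "openin T D"
      moreover have "(\<forall>W\<in>A. D \<subseteq> W) \<longleftrightarrow> (\<forall>W\<in>B. D \<subseteq> W) \<and> (\<forall>W\<in>C. D \<subseteq> W)"
      proof
        assume "(\<forall>W\<in>B. D \<subseteq> W) \<and> (\<forall>W\<in>C. D \<subseteq> W)"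
        moreover have "\<exists>U\<in>B. \<exists>V\<in>C. W = U \<inter> V" if "W \<in> A" for W
          using that A by (fastforce simp: B_def C_def)
        ultimately show "\<forall>W\<in>A. D \<subseteq> W" by (metis le_inf_iff)
      qed (auto simp: B_def C_def)
      ultimately show "D \<subseteq> \<Sqinter>\<^bsub>opens T\<^esub> A \<longleftrightarrow> D \<subseteq> \<Sqinter>\<^bsub>opens T\<^esub> B \<inter> \<Sqinter>\<^bsub>opens T\<^esub> C"
        using oA oB oC by (simp add: subset_opens_Inf_iff)
    qed (use oA oB oC openin_opens_Inf in blast)+
    with mem show "\<Sqinter>\<^bsub>opens T\<^esub> A \<in> {U \<inter> V | U V. U \<in> R \<and> V \<in> S}" by blast
  next
    fix D W assume "D \<in> carrier (opens T)" "W \<in> {U \<inter> V | U V. U \<in> R \<and> V \<in> S}"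
    then obtain U V where D: "openin T D" and UV: "U \<in> R" "V \<in> S" and W: "W = U \<inter> V"
      by auto
    have o: "openin T U" "openin T V" using UV oR oS by auto
    have "heyting (opens T) D W = heyting (opens T) D U \<inter> heyting (opens T) D V"
    proof (rule opens_eqI)
      fix E assume "openin T E"
      then show "E \<subseteq> heyting (opens T) D W \<longleftrightarrow>
          E \<subseteq> heyting (opens T) D U \<inter> heyting (opens T) D V"
        using D o by (simp add: W subset_heyting_opens_iff openin_Int)
    qed (use D o in \<open>auto simp: W openin_heyting openin_Int\<close>)
    moreover have "heyting (opens T) D U \<in> R" "heyting (opens T) D V \<in> S"
      using R S UV D by (auto simp: is_sublocale_def)
    ultimately show "heyting (opens T) D W \<in> {U \<inter> V | U V. U \<in> R \<and> V \<in> S}" by blast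
  }
qed

lemma complemented_opens_cases:
  assumes "complemented_in (sublocales (opens T)) S"
  obtains S' where "is_sublocale (opens T) S'" "S \<inter> S' = {topspace T}"
    "\<And>x. x \<in> topspace T \<Longrightarrow> point_prime T x \<in> S \<or> point_prime T x \<in> S'"
proof -
  interpret frame "opens T" by (rule frame_opens)
  interpret S: complete_lattice "sublocales (opens T)" by (rule complete_lattice_sublocales)
  obtain S' where S: "is_sublocale (opens T) S" and S': "is_sublocale (opens T) S'"
    and meet: "S \<sqinter>\<^bsub>sublocales (opens T)\<^esub> S' = \<bottom>\<^bsub>sublocales (opens T)\<^esub>"
    and join: "S \<squnion>\<^bsub>sublocales (opens T)\<^esub> S' = \<top>\<^bsub>sublocales (opens T)\<^esub>"
    using assms by (auto simp: complemented_in_def)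
  let ?R = "{U \<inter> V | U V. U \<in> S \<and> V \<in> S'}"
  have R: "is_sublocale (opens T) ?R"
    using S S' by (rule is_sublocale_pairwise_Int)
  \<comment> \<open>The whole space belongs to both sublocales and is a neutral partner, so the
    pairwise intersections contain \<open>S\<close> and \<open>S'\<close>, hence their join.\<close>
  have "U = U \<inter> topspace T" "U = topspace T \<inter> U" if "U \<in> S \<union> S'" for U
    using that openin_subset openin_is_sublocale[OF S] openin_is_sublocale[OF S'] by blast+
  then have "S \<subseteq> ?R" "S' \<subseteq> ?R"
    using topspace_in_sublocale[OF S] topspace_in_sublocale[OF S'] by blast+
  then have "\<top>\<^bsub>sublocales (opens T)\<^esub> \<subseteq> ?R"
    using S.join_le[of S ?R S'] S S' R by (simp add: join)
  moreover have "is_sublocale (opens T) (carrier (opens T))"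
    using is_sublocale_Inter[of "{}"] by simp
  then have "carrier (opens T) \<subseteq> \<top>\<^bsub>sublocales (opens T)\<^esub>"
    using S.top_higher[of "carrier (opens T)"] by simp
  ultimately have all: "openin T W \<Longrightarrow> W \<in> ?R" for W by auto
  show thesis
  proof
    show "is_sublocale (opens T) S'" by (rule S')
    have "S \<sqinter>\<^bsub>sublocales (opens T)\<^esub> S' = S \<inter> S'"
      unfolding meet_def using S S' by (subst sublocales_Inf) auto
    then show "S \<inter> S' = {topspace T}"
      by (simp add: meet sublocales_bottom opens_top)
    fix x assume x: "x \<in> topspace T"
    obtain U V where UV: "U \<in> S" "V \<in> S'" and p: "point_prime T x = U \<inter> V"
      using all[OF openin_point_prime] by blast
    have o: "openin T U" "openin T V"
      using UV S S' openin_is_sublocale by blast+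
    have "x \<notin> U \<inter> V"
      using x p subset_point_prime_iff[OF openin_point_prime x] by blast
    \<comment> \<open>The factor missing \<open>x\<close> lies below the prime by maximality, and
      the prime is \<open>U \<inter> V\<close>. This is the primeness argument.\<close>
    then have "U \<subseteq> U \<inter> V \<or> V \<subseteq> U \<inter> V"
      using o x subset_point_prime_iff[of T _ x] p by blast
    then have "U \<inter> V = U \<or> U \<inter> V = V" by blast
    with UV p show "point_prime T x \<in> S \<or> point_prime T x \<in> S'" by auto
  qed
qed

text \<open>For \<open>W\<close> in \<open>S\<close>, the open set
  \<open>heyting (opens T) V W\<close> turns out to lie in both \<open>S\<close> and its complement.
  Hence it is the whole space, which says that \<open>V\<close> is contained in
  \<open>W\<close>.\<close>

lemma Int_subset_closed_sublocale:
  assumes "complemented_in (sublocales (opens T)) S" "openin T V"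
    and "\<And>x. x \<in> V \<Longrightarrow> point_prime T x \<notin> S"
  shows "S \<subseteq> closed_sublocale (opens T) V"
proof
  fix W assume W: "W \<in> S"
  obtain S' where S': "is_sublocale (opens T) S'" and disj: "S \<inter> S' = {topspace T}"
    and cases: "\<And>x. x \<in> topspace T \<Longrightarrow> point_prime T x \<in> S \<or> point_prime T x \<in> S'"
    using complemented_opens_cases[OF assms(1)] by metis
  have S: "is_sublocale (opens T) S"
    using assms(1) by (simp add: complemented_in_def)
  have oW: "openin T W" using S W openin_is_sublocale by blast
  let ?H = "heyting (opens T) V W"
  have "?H \<in> open_sublocale (opens T) V"
    using oW by (auto simp: open_sublocale_def)
  then have "?H = \<Sqinter>\<^bsub>opens T\<^esub> (point_prime T ` (V - ?H))"
    using assms(2) by (intro open_sublocale_eq_Inf_point_prime)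
  \<comment> \<open>By assumption no prime of a point of \<open>V\<close> is in \<open>S\<close>, so
    all of them fall into \<open>S'\<close>.\<close>
  moreover have "point_prime T ` (V - ?H) \<subseteq> S'"
    using assms(3) cases openin_subset[OF assms(2)] by blast
  then have "\<Sqinter>\<^bsub>opens T\<^esub> (point_prime T ` (V - ?H)) \<in> S'"
    using S' by (simp add: is_sublocale_def)
  ultimately have "?H \<in> S'" by simp
  moreover have "?H \<in> S"
    using S W assms(2) by (simp add: is_sublocale_def)
  ultimately have "V \<subseteq> ?H"
    using disj openin_subset[OF assms(2)] by blast
  then show "W \<in> closed_sublocale (opens T) V"
    using assms(2) oW by (simp add: subset_heyting_opens_iff closed_sublocale_def)
qed

section \<open>Density in the bilocale compared with density in the bispace\<close>

lemma i_dense_bispace_iff: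
  assumes "S \<subseteq> {U. openin (sup_topology T) U}"
  shows "i_dense (opens (sup_topology T)) (open_subframes T) i S \<longleftrightarrow>
    (\<forall>V. openin (T i) V \<longrightarrow> V \<noteq> {} \<longrightarrow> \<not> S \<subseteq> closed_sublocale (opens (sup_topology T)) V)"
proof -
  let ?L = "opens (sup_topology T)"
  \<comment> \<open>The empty set is an element of the frame, so it would have to contain
    \<open>V\<close>.\<close>
  have "V = {}" if "carrier ?L \<subseteq> closed_sublocale ?L V" for V
    using that by (auto simp: closed_sublocale_def)
  moreover have "closed_sublocale ?L V \<subseteq> carrier ?L" "closed_sublocale ?L {} = carrier ?L" for V
    by (auto simp: closed_sublocale_def)
  ultimately have closed: "closed_sublocale ?L V = carrier ?L \<longleftrightarrow> V = {}" for V
    by blast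
  let ?F = "{closed_sublocale ?L a | a. a \<in> open_subframes T i \<and> S \<subseteq> closed_sublocale ?L a}"
  \<comment> \<open>The closed sublocale of \<open>{}\<close> keeps the intersection of the family
    inside the carrier.\<close>
  have "carrier ?L \<in> ?F"
    using assms closed[of "{}"] by (intro CollectI exI[of _ "{}"]) (auto simp: open_subframes_def)
  then have "\<Inter>?F = carrier ?L \<longleftrightarrow> (\<forall>C\<in>?F. carrier ?L \<subseteq> C)"
    by blast
  also have "\<dots> \<longleftrightarrow> (\<forall>C\<in>?F. C = carrier ?L)"
    by (auto simp: closed_sublocale_def)
  finally show ?thesis
    unfolding i_dense_def i_closure_def using closed by (auto simp: open_subframes_def)
qed

lemma dense_in_iff:
  assumes "S \<subseteq> topspace T"
  shows "dense_in T S \<longleftrightarrow> (\<forall>V. openin T V \<longrightarrow> V \<noteq> {} \<longrightarrow> S \<inter> V \<noteq> {})"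
  using assms unfolding dense_in_def dense_intersects_open by blast

lemma i_dense_open_sublocale_iff:
  assumes "bispace X T" "i \<in> {1, 2}" "openin (sup_topology T) U"
  shows "i_dense (opens (sup_topology T)) (open_subframes T) i
      (open_sublocale (opens (sup_topology T)) U) \<longleftrightarrow> dense_in (T i) U"
proof -
  let ?\<tau> = "sup_topology T"
  let ?o = "open_sublocale (opens ?\<tau>) U"
  have "?o \<subseteq> closed_sublocale (opens ?\<tau>) V \<longleftrightarrow> U \<inter> V = {}" if "openin ?\<tau> V" for V
  proof
    assume "?o \<subseteq> closed_sublocale (opens ?\<tau>) V"
    \<comment> \<open>The pseudocomplement of \<open>U\<close> is the least element of its open
      sublocale, so it decides containment in a closed sublocale.\<close>
    moreover have "heyting (opens ?\<tau>) U {} \<in> ?o"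
      unfolding open_sublocale_def by (intro CollectI exI[of _ "{}"]) simp
    ultimately have "heyting (opens ?\<tau>) U {} \<in> closed_sublocale (opens ?\<tau>) V"
      by (rule subsetD)
    then have "V \<subseteq> heyting (opens ?\<tau>) U {}"
      by (simp add: closed_sublocale_def)
    then show "U \<inter> V = {}"
      using assms(3) that by (simp add: subset_heyting_opens_iff)
  next
    assume "U \<inter> V = {}"
    then have "heyting (opens ?\<tau>) U W \<in> closed_sublocale (opens ?\<tau>) V" if "openin ?\<tau> W" for W
      using assms(3) \<open>openin ?\<tau> V\<close> that
      by (simp add: subset_heyting_opens_iff closed_sublocale_def openin_heyting)
    then show "?o \<subseteq> closed_sublocale (opens ?\<tau>) V"
      unfolding open_sublocale_def by auto
  qed
  moreover have "?o \<subseteq> {U. openin ?\<tau> U}"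
    using is_sublocale_open_sublocale[OF assms(3)] by (simp add: is_sublocale_def)
  moreover have "U \<subseteq> topspace (T i)"
    using openin_subset[OF assms(3)] topspace_sup_topology[OF assms(1)] assms(1,2)
    by (auto simp: bispace_def)
  ultimately show ?thesis
    using openin_sup_topology[OF assms(2), of T] by (simp add: i_dense_bispace_iff dense_in_iff)
qed

theorem proposition2p4:
  fixes X :: "'a set" and T :: "nat \<Rightarrow> 'a topology" and i j :: nat
  assumes "{i, j} = {1, 2}"
    and "bispace X T"
    and "sup_TD T"
    and "\<And>S. Gdelta_sublocale (opens (sup_topology T)) S \<Longrightarrow>
           complemented_in (sublocales (opens (sup_topology T))) S"
  shows "almost_Baire T i j \<longleftrightarrow>
         Baire_bilocale (opens (sup_topology T)) (open_subframes T) i j"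
proof -
  let ?\<tau> = "sup_topology T"
  let ?L = "opens ?\<tau>"
  let ?o = "open_sublocale ?L"
  let ?dense = "i_dense ?L (open_subframes T) i"
  have ij: "i \<in> {1, 2}" "j \<in> {1, 2}"
    using assms(1) by auto
  note oi = openin_sup_topology[OF ij(1), of T] and oj = openin_sup_topology[OF ij(2), of T]
  have top: "topspace ?\<tau> = X" "topspace (T i) = X"
    using topspace_sup_topology[OF assms(2)] assms(2) ij by (auto simp: bispace_def)
  \<comment> \<open>Complementedness of G-delta sublocales enters here; the density of the
    individual \<open>U n\<close> does not matter for this equivalence.\<close>
  have key: "?dense (\<Inter>n. ?o (U n)) \<longleftrightarrow> dense_in (T i) (\<Inter>n. U n)"
    if U: "\<And>n. openin (T j) (U n)" for U :: "nat \<Rightarrow> 'a set"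
  proof -
    let ?S = "\<Inter>n. ?o (U n)"
    have oU: "openin ?\<tau> (U n)" for n using U oj by blast
    have sub: "is_sublocale ?L (?o (U n))" for n
      using oU by (rule is_sublocale_open_sublocale)
    \<comment> \<open>The meet in the lattice of sublocales is the plain intersection, so the
      hypothesis on G-delta sublocales applies to it.\<close>
    have "\<Sqinter>\<^bsub>sublocales ?L\<^esub> (range (\<lambda>n. ?o (U n))) = ?S"
      using sub by (subst frame.sublocales_Inf[OF frame_opens]) auto
    then have "Gdelta_sublocale ?L ?S"
      unfolding Gdelta_sublocale_def using oU by (intro exI[of _ U]) auto
    then have compl: "complemented_in (sublocales ?L) ?S" by (rule assms(4))
    have mem: "point_prime ?\<tau> x \<in> ?S \<longleftrightarrow> x \<in> (\<Inter>n. U n)" if "x \<in> X" for x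
      using that oU top by (simp add: point_prime_in_open_sublocale_iff)
    have "?S \<subseteq> closed_sublocale ?L V \<longleftrightarrow> (\<Inter>n. U n) \<inter> V = {}" if "openin (T i) V" for V
    proof
      have V: "openin ?\<tau> V" "V \<subseteq> X"
        using that oi openin_subset[OF that] top by auto
      {
        assume "(\<Inter>n. U n) \<inter> V = {}"
        then show "?S \<subseteq> closed_sublocale ?L V"
          using V mem by (intro Int_subset_closed_sublocale[OF compl]) blast+
      next
        assume S: "?S \<subseteq> closed_sublocale ?L V"
        show "(\<Inter>n. U n) \<inter> V = {}"
        proof (intro equals0I)
          fix x assume x: "x \<in> (\<Inter>n. U n) \<inter> V"
          then have "point_prime ?\<tau> x \<in> closed_sublocale ?L V"
            using S V mem[of x] by blast
          then have "V \<subseteq> point_prime ?\<tau> x"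
            by (simp add: closed_sublocale_def)
          then show False
            using x V top subset_point_prime_iff[OF V(1), of x] by auto
        qed
      }
    qed
    moreover have "?S \<subseteq> {U. openin ?\<tau> U}"
      using sub[of 0] by (auto simp: is_sublocale_def)
    moreover have "(\<Inter>n. U n) \<subseteq> topspace (T i)"
      using openin_subset[OF oU, of 0] top by auto
    ultimately show ?thesis
      by (simp add: i_dense_bispace_iff dense_in_iff)
  qed
  \<comment> \<open>This translates the premises of the two Baire conditions, and \<open>key\<close>
    translates their conclusions.\<close>
  have single: "?dense (?o U) \<longleftrightarrow> dense_in (T i) U" if "openin (T j) U" for U
    using assms(2) ij(1) oj[OF that] by (rule i_dense_open_sublocale_iff)
  show ?thesis
  proof
    assume B: "almost_Baire T i j"
    show "Baire_bilocale ?L (open_subframes T) i j"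
      unfolding Baire_bilocale_def
    proof (intro allI impI)
      fix S :: "nat \<Rightarrow> 'a set set"
      assume S: "\<forall>n. ?dense (S n) \<and> i_open ?L (open_subframes T) j (S n)"
      then have "\<forall>n. \<exists>U. openin (T j) U \<and> S n = ?o U"
        by (auto simp: i_open_def open_subframes_def)
      then obtain U where U: "\<And>n. openin (T j) (U n)" "\<And>n. S n = ?o (U n)"
        by metis
      then have "\<forall>n. dense_in (T i) (U n) \<and> openin (T j) (U n)"
        using S single by metis
      with B have "dense_in (T i) (\<Inter>n. U n)" by (simp add: almost_Baire_def)
      with key U show "?dense (\<Inter>n. S n)" by simp
    qed
  next
    assume B: "Baire_bilocale ?L (open_subframes T) i j"
    show "almost_Baire T i j"
      unfolding almost_Baire_def
    proof (intro allI impI)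
      fix U :: "nat \<Rightarrow> 'a set"
      assume U: "\<forall>n. dense_in (T i) (U n) \<and> openin (T j) (U n)"
      then have "\<forall>n. ?dense (?o (U n)) \<and> i_open ?L (open_subframes T) j (?o (U n))"
        using single by (auto simp: i_open_def open_subframes_def)
      with B have "?dense (\<Inter>n. ?o (U n))" by (simp add: Baire_bilocale_def)
      with key U show "dense_in (T i) (\<Inter>n. U n)" by simp
    qed
  qed
qed

end
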